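(* Let $n$ be a positive integer and let $R(n)$ be the set of normal complex $n\times n$ matrices. Then the maximal dimension over $\mathbb{C}$ of a (complex) affine subspace of $M(n\times n,\mathbb{C})$ contained in $R(n)$ is $n$.
   Context: $M(n\times n,\mathbb{C})$ denotes the complex vector space of $n\times n$ complex matrices. A matrix $A\in M(n\times n,\mathbb{C})$ is normal if $AA^{\ast}=A^{\ast}A$, where $A^{\ast}$ is the conjugate transpose of $A$. An affine subspace is a set $S=P+Z$ with $P\in M(n\times n,\mathbb{C})$ and $Z$ a $\mathbb{C}$-linear subspace of $M(n\times n,\mathbb{C})$; its dimension is $\dim_{\mathbb{C}} Z$. "The maximal dimension is $d$" means that every such subspace has dimension at most $d$ and some such subspace has dimension exactly $d$. *)

theory Defs
  imports "HOL-Analysis.Analysis"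
begin

text \<open>
  An \<open>n \<times> n\<close> complex matrix is an element of \<^typ>\<open>complex^'n^'n\<close> with \<open>n = CARD('n)\<close>.
  The class-based scalar multiplication and dimension on this type are over the reals;
  the complex vector space structure is therefore set up explicitly.
\<close>

definition cmat_scale :: "complex \<Rightarrow> complex^'n^'m \<Rightarrow> complex^'n^'m" where
  "cmat_scale c A = (\<chi> i j. c * A $ i $ j)"

global_interpretation cmat: vector_space "cmat_scale :: complex \<Rightarrow> complex^'n^'m \<Rightarrow> complex^'n^'m"
  by unfold_locales (simp_all add: cmat_scale_def vec_eq_iff algebra_simps)

definition conj_transpose :: "complex^'n^'m \<Rightarrow> complex^'m^'n" where
  "conj_transpose A = (\<chi> i j. cnj (A $ j $ i))"

definition normal_matrices :: "(complex^'n^'n) set" where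
  "normal_matrices = {A. A ** conj_transpose A = conj_transpose A ** A}"

text \<open>
  A relation rather than a predicate with a separate dimension function: the dimension \<open>d\<close>
  belongs to the direction \<open>Z\<close>, which is determined by \<open>S\<close> as the set of differences of elements of \<open>S\<close>.
\<close>

definition affine_subspace_of_dim :: "(complex^'n^'m) set \<Rightarrow> nat \<Rightarrow> bool" where
  "affine_subspace_of_dim S d \<longleftrightarrow>
     (\<exists>P Z. cmat.subspace Z \<and> S = (\<lambda>A. P + A) ` Z \<and> cmat.dim Z = d)"

end

theory Submission
  imports Defs
begin

text \<open>
  Let \<open>S = P + Z\<close> consist of normal matrices. Expanding the normality of \<open>P + t Q\<close> in \<open>t\<close> and
  its conjugate shows that all matrices in \<open>Z\<close> are normal, and polarising gives
  \<open>A\<^sup>* B = B A\<^sup>*\<close> for all \<open>A, B\<close> in \<open>Z\<close>. Such a \<open>Z\<close> has a separating vector \<open>v\<close>, i.e.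
  \<open>A v = 0\<close> forces \<open>A = 0\<close> on \<open>Z\<close>, so that \<open>A \<mapsto> A v\<close> embeds \<open>Z\<close> into \<open>\<complex>\<^sup>n\<close>: if \<open>A v = 0\<close> with
  \<open>A \<noteq> 0\<close> in \<open>Z\<close>, then adding to \<open>v\<close> a vector \<open>w = A\<^sup>* u\<close> with \<open>A w \<noteq> 0\<close> makes the annihilator
  of \<open>v\<close> in \<open>Z\<close> strictly smaller, because \<open>B v\<close> and \<open>B w\<close> are orthogonal for every \<open>B\<close> in \<open>Z\<close>.
  Diagonal matrices attain the bound.
\<close>

lemma conj_transpose_add: "conj_transpose (A + B) = conj_transpose A + conj_transpose B"
  by (simp add: conj_transpose_def vec_eq_iff)

lemma conj_transpose_cmat_scale: "conj_transpose (cmat_scale c A) = cmat_scale (cnj c) (conj_transpose A)"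
  by (simp add: conj_transpose_def cmat_scale_def vec_eq_iff)

lemma conj_transpose_conj_transpose [simp]: "conj_transpose (conj_transpose A) = A"
  by (simp add: conj_transpose_def vec_eq_iff)

lemma conj_transpose_0 [simp]: "conj_transpose 0 = 0"
  by (simp add: conj_transpose_def vec_eq_iff)

lemma cmat_scale_mult_left: "cmat_scale c A ** B = cmat_scale c (A ** B)"
  by (simp add: cmat_scale_def matrix_matrix_mult_def vec_eq_iff sum_distrib_left algebra_simps)

lemma cmat_scale_mult_right: "A ** cmat_scale c B = cmat_scale c (A ** B)"
  by (simp add: cmat_scale_def matrix_matrix_mult_def vec_eq_iff sum_distrib_left algebra_simps)

lemma cmat_scale_of_real: "cmat_scale (of_real r) A = r *\<^sub>R A"
  by (simp add: cmat_scale_def vec_eq_iff scaleR_conv_of_real[where 'a=complex])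

lemma matrix_add_rdistrib: "(A + B) ** C = A ** C + B ** C"
  by (simp add: matrix_matrix_mult_def vec_eq_iff sum.distrib distrib_right)

lemma scaleR_matrix_vector_mult: "(r *\<^sub>R A) *v x = r *\<^sub>R (A *v x)" for A :: "complex^'n^'m"
  by (simp add: matrix_vector_mult_def vec_eq_iff scaleR_sum_right)

text \<open>Here \<open>\<bullet>\<close> is the real inner product, the real part of the Hermitian
  one, so the adjoint relation carries over.\<close>

lemma inner_conj_transpose:
  "(conj_transpose A *v x) \<bullet> y = x \<bullet> (A *v (y :: complex^'n))" for A :: "complex^'n^'m"
proof -
  have "(conj_transpose A *v x) \<bullet> y = (\<Sum>i\<in>UNIV. \<Sum>j\<in>UNIV. (cnj (A $ j $ i) * x $ j) \<bullet> y $ i)"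
    by (simp add: inner_vec_def matrix_vector_mult_def conj_transpose_def inner_sum_left)
  also have "\<dots> = (\<Sum>i\<in>UNIV. \<Sum>j\<in>UNIV. x $ j \<bullet> (A $ j $ i * y $ i))"
    by (intro sum.cong refl) (simp add: inner_complex_def algebra_simps)
  also have "\<dots> = (\<Sum>j\<in>UNIV. \<Sum>i\<in>UNIV. x $ j \<bullet> (A $ j $ i * y $ i))"
    by (rule sum.swap)
  also have "\<dots> = x \<bullet> (A *v y)"
    by (simp add: inner_vec_def matrix_vector_mult_def inner_sum_right)
  finally show ?thesis .
qed

lemma conj_transpose_vec_eq_0:
  assumes "A ** conj_transpose A = conj_transpose A ** A" "A *v x = 0"
  shows "conj_transpose A *v x = 0"
proof -
  have "(conj_transpose A *v x) \<bullet> (conj_transpose A *v x) = x \<bullet> (conj_transpose A *v (A *v x))"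
    by (simp add: inner_conj_transpose matrix_vector_mul_assoc assms(1))
  then show ?thesis
    by (simp add: assms(2))
qed

text \<open>The squared norm of \<open>conj_transpose A *v x\<close> equals the inner product of
  \<open>x\<close> with \<open>A ** conj_transpose A\<close> applied to \<open>x\<close>.\<close>

lemma mult_conj_transpose_eq_0:
  assumes "A ** conj_transpose A = 0"
  shows "A = 0"
proof -
  have "(conj_transpose A *v x) \<bullet> (conj_transpose A *v x) = 0" for x
    using assms by (simp add: inner_conj_transpose matrix_vector_mul_assoc)
  then have "conj_transpose A = 0"
    by (simp add: matrix_eq)
  then show ?thesis
    by (metis conj_transpose_0 conj_transpose_conj_transpose)
qed

text \<open>The real dimension serves as the descent measure, so only real subspaces are needed here.\<close>

lemma separating_vector:
  fixes Z :: "(complex^'n^'n) set"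
  assumes Z: "subspace Z"
    and comm: "\<And>A B. A \<in> Z \<Longrightarrow> B \<in> Z \<Longrightarrow> B ** conj_transpose A = conj_transpose A ** B"
  obtains v where "\<And>A. A \<in> Z \<Longrightarrow> A *v v = 0 \<Longrightarrow> A = 0"
proof -
  define K where "K v = {A \<in> Z. A *v v = 0}" for v :: "complex^'n"
  have sK: "subspace (K v)" for v
    using Z unfolding K_def subspace_def
    by (auto simp: matrix_vector_mult_add_rdistrib scaleR_matrix_vector_mult)
  \<comment> \<open>Minimality of the annihilator replaces an explicit descent: any strictly smaller
    \<open>K u\<close> is a contradiction.\<close>
  obtain v where v: "\<And>u. dim (K v) \<le> dim (K u)"
    using ex_has_least_nat[of "\<lambda>_. True" _ "\<lambda>v. dim (K v)"] by blast
  have "A = 0" if A: "A \<in> Z" "A *v v = 0" for A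
  proof (rule ccontr)
    assume "A \<noteq> 0"
    then obtain u where u: "(A ** conj_transpose A) *v u \<noteq> 0"
      using mult_conj_transpose_eq_0 by (metis matrix_eq matrix_vector_mult_0)
    define w where "w = conj_transpose A *v u"
    have Aw: "A *v w \<noteq> 0"
      using u by (simp add: w_def matrix_vector_mul_assoc)
    \<comment> \<open>\<open>B *v v\<close> lies in the kernel of \<open>A\<close> and
      \<open>B *v w\<close> in the range of its adjoint. Real orthogonality suffices, since it is
      applied when \<open>B *v w = - (B *v v)\<close>.\<close>
    have orth: "(B *v v) \<bullet> (B *v w) = 0" if "B \<in> Z" for B
    proof -
      have "conj_transpose A *v (B *v v) = B *v (conj_transpose A *v v)"
        using comm[OF A(1) that] by (simp add: matrix_vector_mul_assoc)
      also have "\<dots> = 0"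
        using conj_transpose_vec_eq_0[OF comm[OF A(1) A(1)] A(2)] by simp
      finally have "A *v (B *v v) = 0"
        using conj_transpose_vec_eq_0[of "conj_transpose A"] comm[OF A(1) A(1)] by simp
      moreover have "B *v w = conj_transpose A *v (B *v u)"
        using comm[OF A(1) that] by (simp add: w_def matrix_vector_mul_assoc)
      ultimately show ?thesis
        by (metis inner_commute inner_conj_transpose inner_zero_right)
    qed
    have "B *v v = 0" if B: "B \<in> K (v + w)" for B
    proof -
      have "B *v w = - (B *v v)"
        using B by (simp add: K_def matrix_vector_right_distrib eq_neg_iff_add_eq_0 add.commute)
      then show ?thesis
        using orth[of B] B by (simp add: K_def)
    qed
    then have "K (v + w) \<subseteq> K v"
      by (auto simp: K_def)
    moreover have "A \<in> K v" "A \<notin> K (v + w)"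
      using A Aw by (auto simp: K_def matrix_vector_right_distrib)
    ultimately have "span (K (v + w)) \<subset> span (K v)"
      unfolding span_eq_iff[THEN iffD2, OF sK] by blast
    then have "dim (K (v + w)) < dim (K v)"
      by (rule dim_psubset)
    with v[of "v + w"] show False
      by simp
  qed
  then show ?thesis
    using that by blast
qed

lemma normal_direction_commutes:
  fixes P :: "complex^'n^'n"
  assumes Z: "cmat.subspace Z" and N: "(\<lambda>A. P + A) ` Z \<subseteq> normal_matrices"
    and A: "A \<in> Z" and B: "B \<in> Z"
  shows "B ** conj_transpose A = conj_transpose A ** B"
proof -
  \<comment> \<open>This commutator is linear in \<open>X\<close> and conjugate-linear in
    \<open>Y\<close>, and \<open>X\<close> is normal iff \<open>f X X = 0\<close>.\<close>
  define f where "f X Y = X ** conj_transpose Y - conj_transpose Y ** X" for X Y :: "complex^'n^'n"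
  have add: "f (X + X') (Y + Y') = f X Y + f X Y' + f X' Y + f X' Y'" for X X' Y Y'
    by (simp add: f_def conj_transpose_add matrix_add_ldistrib matrix_add_rdistrib)
  have scale: "f (cmat_scale c X) Y = cmat_scale c (f X Y)"
      "f X (cmat_scale c Y) = cmat_scale (cnj c) (f X Y)" for c X Y
    by (simp_all add: f_def conj_transpose_cmat_scale cmat_scale_mult_left cmat_scale_mult_right
        cmat.scale_right_diff_distrib)
  have fP: "f (P + Q) (P + Q) = 0" if "Q \<in> Z" for Q
    using N that by (auto simp: f_def normal_matrices_def)
  have normal: "f Q Q = 0" if Q: "Q \<in> Z" for Q
  proof -
    have PP: "f P P = 0"
      using fP[OF cmat.subspace_0[OF Z]] by simp
    have 1: "f P Q + f Q P + f Q Q = 0"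
      using fP[OF Q] by (simp add: add PP)
    \<comment> \<open>Replacing \<open>Q\<close> by its negative flips only the cross terms, so
      adding the two identities isolates \<open>f Q Q\<close>.\<close>
    have "f (P + cmat_scale (-1) Q) (P + cmat_scale (-1) Q) = 0"
      using Q Z by (intro fP) (simp add: cmat.subspace_neg)
    then have 2: "- f P Q - f Q P + f Q Q = 0"
      unfolding add scale by (simp add: PP)
    have "(f P Q + f Q P + f Q Q) + (- f P Q - f Q P + f Q Q) = 2 *\<^sub>R f Q Q"
      by (simp add: scaleR_2)
    then show ?thesis
      unfolding 1 2 by simp
  qed
  have 1: "f A B + f B A = 0"
    using normal[OF cmat.subspace_add[OF Z A B]] by (simp add: add normal A B)
  \<comment> \<open>With \<open>\<i>\<close> times \<open>B\<close> in place of \<open>B\<close>,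
    the two cross terms acquire opposite factors. Together with \<open>1\<close> this makes each of
    them vanish.\<close>
  have "cmat_scale (- \<i>) (f A B) + cmat_scale \<i> (f B A) = 0"
    using normal[OF cmat.subspace_add[OF Z A cmat.subspace_scale[OF Z B, of \<i>]]]
    unfolding add scale by (simp add: normal A B)
  moreover have "f A B = - f B A"
    using 1 by (simp add: eq_neg_iff_add_eq_0)
  ultimately have "cmat_scale (2 * \<i>) (f B A) = 0"
    by (simp add: vec_eq_iff cmat_scale_def)
  then have "f B A = 0"
    by simp
  then show ?thesis
    by (simp add: f_def)
qed

text \<open>Evaluation at \<open>v\<close> is complex linear and injective on \<open>Z\<close>, so
  it sends a basis of \<open>Z\<close> to independent vectors.\<close>

lemma cmat_dim_le_of_separating_vector:
  fixes Z :: "(complex^'n^'m) set"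
  assumes Z: "cmat.subspace Z" and v: "\<And>A. A \<in> Z \<Longrightarrow> A *v v = 0 \<Longrightarrow> A = 0"
  shows "cmat.dim Z \<le> CARD('m)"
proof -
  interpret p: vector_space_pair "cmat_scale :: complex \<Rightarrow> complex^'n^'m \<Rightarrow> _" "(*s) :: complex \<Rightarrow> complex^'m \<Rightarrow> _" ..
  have lin: "Vector_Spaces.linear cmat_scale (*s) (\<lambda>A :: complex^'n^'m. A *v v)"
    unfolding Vector_Spaces.linear_iff
    by (simp add: cmat.vector_space_axioms vec.vector_space_axioms matrix_vector_mult_add_rdistrib cmat_scale_def matrix_vector_mult_def
        vec_eq_iff sum_distrib_left sum.distrib algebra_simps)
  obtain B where B: "B \<subseteq> Z" "cmat.independent B" "card B = cmat.dim Z"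
    using cmat.basis_exists by metis
  have "cmat.span B \<subseteq> Z"
    using B(1) Z by (rule cmat.span_minimal)
  then have inj: "inj_on (\<lambda>A. A *v v) (cmat.span B)"
    by (subst p.linear_inj_on_iff_eq_0[OF lin cmat.subspace_span]) (use v in blast)
  have "vec.independent ((\<lambda>A. A *v v) ` B)"
    using lin B(2) inj by (rule p.linear_independent_injective_image)
  then have "card ((\<lambda>A. A *v v) ` B) \<le> CARD('m)"
    by (metis vec.independent_card_le_dim subset_UNIV vec_dim_card)
  moreover have "card ((\<lambda>A. A *v v) ` B) = card B"
    by (rule card_image) (use inj cmat.span_superset inj_on_subset in blast)
  ultimately show ?thesis
    using B(3) by simp
qed

text \<open>The map \<open>d\<close> is an injective linear map, so its range inherits the dimension
  of its domain; diagonal matrices commute with each other.\<close>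

lemma diagonal_matrices_affine_subspace:
  defines "d \<equiv> (\<lambda>x :: complex^'n. \<chi> i j. if i = j then x $ i else 0)"
  shows "affine_subspace_of_dim (range d) CARD('n)" "range d \<subseteq> normal_matrices"
proof -
  interpret p: finite_dimensional_vector_space_pair_1 "(*s) :: complex \<Rightarrow> complex^'n \<Rightarrow> _" cart_basis
    "cmat_scale :: complex \<Rightarrow> complex^'n^'n \<Rightarrow> _" ..
  have lin: "Vector_Spaces.linear (*s) cmat_scale d"
    unfolding Vector_Spaces.linear_iff
    by (simp add: cmat.vector_space_axioms vec.vector_space_axioms d_def cmat_scale_def vec_eq_iff)
  have inj: "inj d"
    by (rule injI) (simp add: d_def vec_eq_iff, metis)
  have "cmat.dim (range d) = CARD('n)"
    using p.dim_image_eq[OF lin, of UNIV] inj by (simp add: card_cart_basis)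
  moreover have "cmat.subspace (range d)"
    using p.linear_subspace_image[OF lin vec.subspace_UNIV] .
  ultimately show "affine_subspace_of_dim (range d) CARD('n)"
    unfolding affine_subspace_of_dim_def by (intro exI[of _ 0] exI[of _ "range d"]) simp
  show "range d \<subseteq> normal_matrices"
    by (auto simp: normal_matrices_def d_def conj_transpose_def matrix_matrix_mult_def vec_eq_iff
        if_distrib[of cnj] if_distrib[of "\<lambda>x. x * _"] if_distrib[of "\<lambda>x. _ * x"] mult.commute cong: if_cong)
qed

theorem theorem10:
  shows "(\<forall>(S :: (complex^'n^'n) set) d.
            affine_subspace_of_dim S d \<and> S \<subseteq> normal_matrices \<longrightarrow> d \<le> CARD('n)) \<and>
         (\<exists>S :: (complex^'n^'n) set.
            affine_subspace_of_dim S CARD('n) \<and> S \<subseteq> normal_matrices)"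
proof (intro conjI allI impI)
  fix S :: "(complex^'n^'n) set" and d
  assume S: "affine_subspace_of_dim S d \<and> S \<subseteq> normal_matrices"
  then obtain P Z where Z: "cmat.subspace Z" and S_eq: "S = (\<lambda>A. P + A) ` Z" and d: "cmat.dim Z = d"
    unfolding affine_subspace_of_dim_def by blast
  \<comment> \<open>Restricting scalars to the reals gives access to
    \<open>separating_vector\<close>; the final bound is again over the complex numbers.\<close>
  have "subspace Z"
    using Z unfolding subspace_def cmat.subspace_def by (metis cmat_scale_of_real)
  moreover have "B ** conj_transpose A = conj_transpose A ** B" if "A \<in> Z" "B \<in> Z" for A B
    using normal_direction_commutes[OF Z] S S_eq that by blast
  ultimately obtain v where "\<And>A. A \<in> Z \<Longrightarrow> A *v v = 0 \<Longrightarrow> A = 0"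
    using separating_vector by metis
  then show "d \<le> CARD('n)"
    using cmat_dim_le_of_separating_vector[OF Z] d by blast
next
  show "\<exists>S :: (complex^'n^'n) set. affine_subspace_of_dim S CARD('n) \<and> S \<subseteq> normal_matrices"
    using diagonal_matrices_affine_subspace by blast
qed

end
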